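(* Let $p$ be a prime, $e\ge 1$ an integer, $g$ an integer that is a unit modulo $p$, $m$ the multiplicative order of $g$ modulo $p$, and $c\in\mathbb{Z}$. Then for all $x\in\mathbb{Z}$, $$g^{x-1+c+mp^e}-(x+mp^e)\equiv g^{x-1+c}-x \pmod{p^e}.$$ In other words, $f(x,c)=f(x+mp^e,c)$, where $f(x,c)=g^{x-1+c}-x \pmod{p^e}$.
   Context: The function $f:\mathbb{Z}\times\mathbb{Z}\to\mathbb{Z}/p^e\mathbb{Z}$ is defined with $g$ fixed; powers of $g$ with negative exponents are understood in the unit group $(\mathbb{Z}/p^e\mathbb{Z})^\times$. *)

theory Defs
  imports "HOL-Number_Theory.Number_Theory"
begin

text \<open>
  The integer power of \<open>g\<close> in the unit group of \<open>\<int>/n\<int>\<close>, as the representative in \<open>{0..n - 1}\<close>.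
  The power is taken in \<^term>\<open>units_of (residue_ring n)\<close>, so that the inverse used for a negative
  exponent is the one of that group. Meaningful only for \<open>n > 1\<close> and \<open>g\<close> coprime to \<open>n\<close>.
\<close>
definition residue_pow :: "int \<Rightarrow> int \<Rightarrow> int \<Rightarrow> int" where
  "residue_pow n g k = (g mod n) [^]\<^bsub>units_of (residue_ring n)\<^esub> k"

definition pow_diff :: "nat \<Rightarrow> nat \<Rightarrow> int \<Rightarrow> int \<Rightarrow> int \<Rightarrow> int" where
  "pow_diff p e g x c =
     residue_pow (int p ^ e) g (x - 1 + c) \<ominus>\<^bsub>residue_ring (int p ^ e)\<^esub> (x mod int p ^ e)"

end

theory Submission
  imports Defs
begin

text \<open>
  Since \<open>g ^ m\<close> is 1 modulo \<open>p\<close> and raising to the power \<open>p\<close> improves a congruence to 1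
  modulo \<open>p ^ k\<close> to one modulo \<open>p ^ (k + 1)\<close>, we get \<open>g ^ (m * p ^ e) = 1\<close> already modulo
  \<open>p ^ (e + 1)\<close>. So shifting the exponent by \<open>m * p ^ e\<close> does not change the power of \<open>g\<close>.
\<close>

text \<open>\<open>ord\<close> is a \<open>LEAST\<close>, so it inherits its defining property once
  one positive exponent is known to have it; Euler's theorem supplies
  \<open>totient (nat n)\<close>.\<close>

lemma power_ord_cong_1_int:
  fixes a n :: int
  assumes "n > 1" and "coprime a n"
  shows "[a ^ ord n a = 1] (mod n)"
proof -
  interpret residues n "residue_ring n"
    by unfold_locales (use assms in auto)
  have "totient (nat n) > 0 \<and> [a ^ totient (nat n) = 1] (mod n)"
    using euler_theorem[OF assms(2)] assms(1) by simp
  then have "[a ^ (LEAST d. d > 0 \<and> [a ^ d = 1] (mod n)) = 1] (mod n)"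
    by (rule LeastI2) simp
  then show ?thesis
    using assms(2) by (simp add: ord_def coprime_commute)
qed

text \<open>Factor \<open>b ^ p - 1\<close> as \<open>b - 1\<close> times the sum of the
  \<open>b ^ i\<close> for \<open>i < p\<close>. Induction gives \<open>p ^ Suc k\<close> in the
  first factor; the second is a sum of \<open>p\<close> terms, each 1 modulo \<open>p\<close>, and
  so contributes one more \<open>p\<close>.\<close>

lemma cong_1_power_power:
  fixes a :: int
  assumes "[a = 1] (mod int p)"
  shows "[a ^ p ^ k = 1] (mod int p ^ Suc k)"
proof (induction k)
  case 0
  then show ?case
    using assms by simp
next
  case (Suc k)
  define b where "b = a ^ p ^ k"
  have "[b = 1 ^ p ^ k] (mod int p)"
    unfolding b_def by (intro cong_pow assms)
  then have "[(\<Sum>i<p. b ^ i) = (\<Sum>i<p. 1 ^ i)] (mod int p)"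
    by (intro cong_sum cong_pow) simp
  then have "int p dvd (\<Sum>i<p. b ^ i)"
    by (simp add: cong_def dvd_eq_mod_eq_0)
  moreover have "int p ^ Suc k dvd b - 1"
    using Suc by (simp add: b_def cong_iff_dvd_diff)
  ultimately have "int p ^ Suc k * int p dvd b ^ p - 1"
    unfolding power_diff_1_eq by (rule mult_dvd_mono[rotated])
  then show ?case
    by (simp add: b_def cong_iff_dvd_diff mult_ac flip: power_mult)
qed

lemma residue_pow_add_period:
  fixes n g k :: int
  assumes "n > 1" and "coprime g n" and "[g ^ d = 1] (mod n)"
  shows "residue_pow n g (k + int d) = residue_pow n g k"
proof -
  interpret R: residues n "residue_ring n"
    by unfold_locales (use assms in auto)
  interpret U: group "units_of (residue_ring n)"
    by (rule R.units_group)
  have unit: "g mod n \<in> Units (residue_ring n)"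
    using assms by simp
  then have carr: "g mod n \<in> carrier (units_of (residue_ring n))"
    by (simp add: units_of_carrier)
  \<comment> \<open>As \<open>d\<close> is natural, this power can be computed in the ring, where
    the congruence applies. Adding exponents, with \<open>k\<close> possibly negative, is left to
    the unit group.\<close>
  have "(g mod n) [^]\<^bsub>units_of (residue_ring n)\<^esub> int d = (g mod n) [^]\<^bsub>residue_ring n\<^esub> d"
    using R.units_of_pow[OF unit] by (simp add: int_pow_int)
  also have "\<dots> = \<one>\<^bsub>residue_ring n\<^esub>"
    using assms(3) by (simp add: R.pow_cong R.one_cong cong_def)
  also have "\<dots> = \<one>\<^bsub>units_of (residue_ring n)\<^esub>"
    by (simp add: units_of_one)
  finally show ?thesis
    unfolding residue_pow_def using carr by (simp add: U.int_pow_mult)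
qed

theorem theorem2:
  fixes p e m :: nat and g c :: int
  assumes "prime p"
    and "e \<ge> 1"
    and "coprime g (int p)"
    and "m = ord (int p) g"
  shows "\<forall>x :: int.
    [residue_pow (int p ^ e) g (x - 1 + c + int m * int p ^ e) - (x + int m * int p ^ e)
       = residue_pow (int p ^ e) g (x - 1 + c) - x] (mod (int p ^ e))
    \<and> pow_diff p e g x c = pow_diff p e g (x + int m * int p ^ e) c"
proof
  fix x :: int
  let ?n = "int p ^ e"
  have p: "int p > 1"
    using prime_gt_1_nat[OF assms(1)] by simp
  have n: "?n > 1"
    using p assms(2) by (intro one_less_power) auto
  have "[g ^ m = 1] (mod int p)"
    using power_ord_cong_1_int[OF p assms(3)] assms(4) by simp
  then have "[(g ^ m) ^ p ^ e = 1] (mod int p ^ Suc e)"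
    by (rule cong_1_power_power)
  then have "[g ^ (m * p ^ e) = 1] (mod ?n)"
    unfolding power_mult by (rule cong_dvd_modulus) simp
  then have shift: "residue_pow ?n g (k + int m * ?n) = residue_pow ?n g k" for k
    using residue_pow_add_period[OF n, of g "m * p ^ e" k] assms(3) by simp
  \<comment> \<open>Brings the exponent in \<open>pow_diff\<close> into the form that
    \<open>shift\<close> rewrites.\<close>
  have "x + int m * ?n - 1 + c = x - 1 + c + int m * ?n"
    by simp
  then have "pow_diff p e g x c = pow_diff p e g (x + int m * ?n) c"
    by (simp only: pow_diff_def shift mod_mult_self1)
  \<comment> \<open>By \<open>shift\<close> the powers cancel, and the two sides differ by a
    multiple of \<open>?n\<close>.\<close>
  then show "[residue_pow ?n g (x - 1 + c + int m * ?n) - (x + int m * ?n)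
       = residue_pow ?n g (x - 1 + c) - x] (mod ?n)
    \<and> pow_diff p e g x c = pow_diff p e g (x + int m * ?n) c"
    by (simp add: shift cong_iff_dvd_diff)
qed

end
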